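(* Let $(S,+)$ be a commutative cancellative semigroup and let $S-S$ denote its difference group. If $A\subseteq S$ is a $J$-set in $S$, then $A$ is a $J$-set in $S-S$.
   Context: For a commutative cancellative semigroup $(S,+)$, the difference group $(S-S,+)$ consists of all $a-b$ with $a,b\in S$, where $a-b$ is the element with $b+(a-b)=a$; it is a commutative group and $S\subseteq S-S$. For a set $Y$, $\mathcal P_f(Y)$ is the set of finite nonempty subsets of $Y$. For a semigroup $(X,\cdot)$ (written additively when commutative), let $\mathcal T_X={}^{\mathbb N}X$ be the set of sequences in $X$; for $m\in\mathbb N$ let $\mathcal J_m=\{(t(1),\dots,t(m))\in\mathbb N^m: t(1)<\dots<t(m)\}$; for $a\in X^{m+1}$, $t\in\mathcal J_m$, $f\in\mathcal T_X$ put $x(m,a,t,f)=\bigl(\prod_{j=1}^m a(j)\cdot f(t(j))\bigr)\cdot a(m+1)$. A set $B\subseteq X$ is a $J$-set in $X$ if for each $F\in\mathcal P_f(\mathcal T_X)$ there exist $m\in\mathbb N$, $a\in X^{m+1}$, $t\in\mathcal J_m$ such that $x(m,a,t,f)\in B$ for every $f\in F$. (In the commutative additive case this says: for each finite set $F$ of sequences in $X$ there are $a\in X$ and a finite nonempty $K\subseteq\mathbb N$ with $a+\sum_{t\in K}f(t)\in B$ for all $f\in F$.) *)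

theory Defs
  imports Main
begin

section \<open>J-sets\<close>

text \<open>
  Here \<open>\<nat> = {1, 2, \<dots>}\<close>. A sequence in \<open>X\<close> is a function \<open>nat \<Rightarrow> X\<close> that is only ever
  evaluated at arguments \<open>\<ge> 1\<close>; similarly the tuples \<open>a \<in> X\<^sup>m\<^sup>+\<^sup>1\<close> and
  \<open>t \<in> \<nat>\<^sup>m\<close> are functions on \<open>nat\<close> of which only the values at \<open>1, \<dots>, m + 1\<close> and
  \<open>1, \<dots>, m\<close> matter. The semigroup operation is written \<open>+\<close>, but
  \<^class>\<open>semigroup_add\<close> does not assume commutativity.
\<close>

definition increasing_tuples :: "nat \<Rightarrow> (nat \<Rightarrow> nat) set" where
  "increasing_tuples m = {t. t ` {1..m} \<subseteq> {1..} \<and> strict_mono_on {1..m} t}"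

text \<open>
  A semigroup need not have a unit, so the ordered product
  \<open>g 1 + \<dots> + g m\<close> starts at \<open>g 1\<close>; it is meant for \<open>m \<ge> 1\<close>.
\<close>

definition ordered_sum :: "nat \<Rightarrow> (nat \<Rightarrow> 'a::semigroup_add) \<Rightarrow> 'a" where
  "ordered_sum m g = foldl (+) (g 1) (map g [2..<Suc m])"

definition x_elem ::
  "nat \<Rightarrow> (nat \<Rightarrow> 'a::semigroup_add) \<Rightarrow> (nat \<Rightarrow> nat) \<Rightarrow> (nat \<Rightarrow> 'a) \<Rightarrow> 'a" where
  "x_elem m a t f = ordered_sum m (\<lambda>j. a j + f (t j)) + a (m + 1)"

definition J_set :: "'a::semigroup_add set \<Rightarrow> bool" where
  "J_set B \<longleftrightarrow>
    (\<forall>F :: (nat \<Rightarrow> 'a) set. finite F \<and> F \<noteq> {} \<longrightarrow>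
      (\<exists>m\<ge>1. \<exists>a. \<exists>t\<in>increasing_tuples m. \<forall>f\<in>F. x_elem m a t f \<in> B))"

section \<open>The difference group\<close>

text \<open>
  The sort \<open>{ab_semigroup_add, cancel_semigroup_add}\<close> is exactly that of commutative
  cancellative semigroups; unlike \<^class>\<open>cancel_ab_semigroup_add\<close> it carries no subtraction.
  The pair \<open>(a, b)\<close> represents \<open>a - b\<close>.
\<close>

definition diff_rel ::
  "'a::{ab_semigroup_add, cancel_semigroup_add} \<times> 'a \<Rightarrow> 'a \<times> 'a \<Rightarrow> bool" where
  "diff_rel p q \<longleftrightarrow> fst p + snd q = fst q + snd p"

lemma equivp_diff_rel:
  "equivp (diff_rel :: 'a::{ab_semigroup_add, cancel_semigroup_add} \<times> 'a \<Rightarrow> _)"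
proof (rule equivpI)
  show "reflp (diff_rel :: 'a \<times> 'a \<Rightarrow> _)" by (simp add: reflp_def diff_rel_def)
  show "symp (diff_rel :: 'a \<times> 'a \<Rightarrow> _)" by (simp add: symp_def diff_rel_def)
  show "transp (diff_rel :: 'a \<times> 'a \<Rightarrow> _)"
  proof (rule transpI)
    fix p q r :: "'a \<times> 'a"
    assume pq: "diff_rel p q" and qr: "diff_rel q r"
    have "snd q + (fst p + snd r) = (fst p + snd q) + snd r"
      by (simp add: ac_simps)
    also have "\<dots> = (fst q + snd r) + snd p"
      using pq by (simp add: diff_rel_def ac_simps)
    also have "\<dots> = snd q + (fst r + snd p)"
      using qr by (simp add: diff_rel_def ac_simps)
    finally show "diff_rel p r"
      by (simp add: diff_rel_def)
  qed
qed

quotient_type (overloaded) 'a difference_group =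
  "'a::{ab_semigroup_add, cancel_semigroup_add} \<times> 'a" / diff_rel
  by (rule equivp_diff_rel)

instantiation difference_group :: ("{ab_semigroup_add, cancel_semigroup_add}") ab_group_add
begin

lift_definition zero_difference_group :: "'a difference_group" is "(undefined, undefined)" .

lift_definition plus_difference_group ::
  "'a difference_group \<Rightarrow> 'a difference_group \<Rightarrow> 'a difference_group"
  is "\<lambda>p q. (fst p + fst q, snd p + snd q)"
proof -
  fix p q r s :: "'a \<times> 'a"
  assume 1: "diff_rel p q" and 2: "diff_rel r s"
  have "(fst p + fst r) + (snd q + snd s) = (fst p + snd q) + (fst r + snd s)"
    by (simp add: ac_simps)
  also have "\<dots> = (fst q + snd p) + (fst s + snd r)"
    using 1 2 by (simp add: diff_rel_def)
  also have "\<dots> = (fst q + fst s) + (snd p + snd r)"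
    by (simp add: ac_simps)
  finally show "diff_rel (fst p + fst r, snd p + snd r) (fst q + fst s, snd q + snd s)"
    by (simp add: diff_rel_def)
qed

lift_definition uminus_difference_group :: "'a difference_group \<Rightarrow> 'a difference_group"
  is "\<lambda>(a, b). (b, a)"
  by (auto simp: diff_rel_def ac_simps)

definition minus_difference_group ::
  "'a difference_group \<Rightarrow> 'a difference_group \<Rightarrow> 'a difference_group" where
  "minus_difference_group x y = x + - y"

instance
proof
  fix a b c :: "'a difference_group"
  show "a + b + c = a + (b + c)"
    by transfer (auto simp: diff_rel_def ac_simps)
  show "a + b = b + a"
    by transfer (auto simp: diff_rel_def ac_simps)
  show "0 + a = a"
    by transfer (auto simp: diff_rel_def ac_simps)
  show "- a + a = 0"
    by transfer (auto simp: diff_rel_def ac_simps)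
  show "a - b = a + - b"
    by (rule minus_difference_group_def)
qed

end

text \<open>The inclusion of \<open>S\<close> in \<open>S - S\<close>, sending \<open>s\<close> to \<open>(s + s) - s\<close>.\<close>

lift_definition diff_embed ::
  "'a::{ab_semigroup_add, cancel_semigroup_add} \<Rightarrow> 'a difference_group"
  is "\<lambda>s. (s + s, s)" .

lemma diff_embed_add: "diff_embed (a + b) = diff_embed a + diff_embed b"
  by transfer (simp add: diff_rel_def ac_simps)

lemma inj_diff_embed:
  "inj (diff_embed :: 'a::{ab_semigroup_add, cancel_semigroup_add} \<Rightarrow> _)"
proof (rule injI)
  fix a b :: 'a
  assume "diff_embed a = diff_embed b"
  then have "(a + b) + a = (a + b) + b"
    by transfer (simp add: diff_rel_def ac_simps)
  then show "a = b" by (rule add_left_imp_eq)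
qed

lemma difference_group_eq_diff: "\<exists>a b. x = diff_embed a - diff_embed b"
proof -
  have "\<exists>a b. x = diff_embed a + - diff_embed b"
    by transfer (auto simp: diff_rel_def ac_simps)
  then show ?thesis by simp
qed

end

theory Submission imports Defs begin

text \<open>
  Finitely many elements of \<open>S - S\<close> have a common denominator in \<open>S\<close>. So for a finite set \<open>F\<close>
  of sequences in \<open>S - S\<close> there is a sequence \<open>c\<close> such that \<open>c + f\<close> lies in \<open>S\<close> for all
  \<open>f \<in> F\<close>. A witness \<open>(a, t)\<close> for these translates in \<open>S\<close> becomes one for \<open>F\<close> in \<open>S - S\<close> by
  absorbing \<open>c (t j)\<close> into \<open>a j\<close> for \<open>j \<le> m\<close>.
\<close>

lemma ordered_sum_cong:
  assumes "m \<ge> 1" and "\<And>j. 1 \<le> j \<Longrightarrow> j \<le> m \<Longrightarrow> g j = h j"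
  shows "ordered_sum m g = ordered_sum m h"
proof -
  have "g 1 = h 1" and "map g [2..<Suc m] = map h [2..<Suc m]"
    using assms by auto
  then show ?thesis
    unfolding ordered_sum_def by (rule arg_cong2)
qed

lemma ordered_sum_hom:
  assumes hom: "\<And>x y. h (x + y) = h x + h y"
  shows "h (ordered_sum m g) = ordered_sum m (\<lambda>j. h (g j))"
proof -
  have "h (foldl (+) z (map g js)) = foldl (+) (h z) (map (\<lambda>j. h (g j)) js)" for z js
    by (induction js arbitrary: z) (simp_all add: hom)
  then show ?thesis
    by (simp add: ordered_sum_def)
qed

lemma x_elem_hom:
  assumes hom: "\<And>x y. h (x + y) = h x + h y"
  shows "h (x_elem m a t f) = x_elem m (\<lambda>j. h (a j)) t (\<lambda>n. h (f n))"
  by (simp add: x_elem_def hom ordered_sum_hom [of h, OF hom])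

lemma x_elem_translate:
  assumes "m \<ge> 1"
  shows "x_elem m a t (\<lambda>n. c n + f n) = x_elem m (\<lambda>j. if j \<le> m then a j + c (t j) else a j) t f"
proof -
  have "ordered_sum m (\<lambda>j. a j + (c (t j) + f (t j)))
      = ordered_sum m (\<lambda>j. (if j \<le> m then a j + c (t j) else a j) + f (t j))"
    using assms by (intro ordered_sum_cong) (simp_all add: add.assoc)
  then show ?thesis
    by (simp add: x_elem_def)
qed

lemma sequences_common_denominator:
  fixes h :: "'a \<Rightarrow> 'b::plus" and F :: "('i \<Rightarrow> 'b) set"
  assumes denominator: "\<And>X. finite X \<Longrightarrow> \<exists>c. \<forall>x\<in>X. c + x \<in> range h"
    and "finite F"
  shows "\<exists>c. \<forall>n. \<forall>f\<in>F. c n + f n \<in> range h"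
proof (intro choice allI)
  fix n
  show "\<exists>c. \<forall>f\<in>F. c + f n \<in> range h"
    using denominator [of "(\<lambda>f. f n) ` F"] \<open>finite F\<close> by simp
qed

lemma J_set_hom_image:
  fixes h :: "'a::semigroup_add \<Rightarrow> 'b::semigroup_add"
  assumes hom: "\<And>x y. h (x + y) = h x + h y"
    and denominator: "\<And>X. finite X \<Longrightarrow> \<exists>c. \<forall>x\<in>X. c + x \<in> range h"
    and "J_set A"
  shows "J_set (h ` A)"
  unfolding J_set_def
proof (intro allI impI, elim conjE)
  fix F :: "(nat \<Rightarrow> 'b) set"
  assume "finite F" and "F \<noteq> {}"
  obtain c where c: "\<forall>n. \<forall>f\<in>F. c n + f n \<in> range h"
    using sequences_common_denominator [OF denominator \<open>finite F\<close>] by (rule exE)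
  define lift where "lift f n = inv h (c n + f n)" for f n
  have h_lift: "h (lift f n) = c n + f n" if "f \<in> F" for f n
    using c that by (simp add: lift_def f_inv_into_f)
  have "finite (lift ` F)" and "lift ` F \<noteq> {}"
    using \<open>finite F\<close> \<open>F \<noteq> {}\<close> by simp_all
  then obtain m a t where "m \<ge> 1" and t: "t \<in> increasing_tuples m"
    and in_A: "\<forall>g\<in>lift ` F. x_elem m a t g \<in> A"
    using \<open>J_set A\<close> unfolding J_set_def by blast
  define b where "b j = (if j \<le> m then h (a j) + c (t j) else h (a j))" for j
  have "x_elem m b t f \<in> h ` A" if "f \<in> F" for f
  proof -
    have "x_elem m b t f = x_elem m (\<lambda>j. h (a j)) t (\<lambda>n. c n + f n)"
      unfolding b_def using \<open>m \<ge> 1\<close> by (rule x_elem_translate [symmetric])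
    also have "\<dots> = h (x_elem m a t (lift f))"
      by (simp add: x_elem_hom [of h, OF hom] h_lift [OF that])
    finally show ?thesis
      using in_A that by simp
  qed
  then show "\<exists>m\<ge>1. \<exists>b. \<exists>t\<in>increasing_tuples m. \<forall>f\<in>F. x_elem m b t f \<in> h ` A"
    using \<open>m \<ge> 1\<close> t by blast
qed

lemma difference_group_common_denominator:
  fixes X :: "'a::{ab_semigroup_add, cancel_semigroup_add} difference_group set"
  assumes "finite X"
  shows "\<exists>c. \<forall>x\<in>X. diff_embed c + x \<in> range diff_embed"
  using assms
proof (induction X)
  case empty
  show ?case by simp
next
  case (insert y X)
  then obtain c where c: "\<forall>x\<in>X. diff_embed c + x \<in> range diff_embed" by blast
  obtain p q where y: "y = diff_embed p - diff_embed q"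
    using difference_group_eq_diff by blast
  have "diff_embed (q + c) + y = diff_embed (c + p)"
    by (simp add: y diff_embed_add)
  moreover have "diff_embed (q + c) + x \<in> range diff_embed" if "x \<in> X" for x
  proof -
    from c that obtain s where "diff_embed c + x = diff_embed s" by blast
    then have "diff_embed (q + c) + x = diff_embed (q + s)"
      by (simp add: diff_embed_add add.assoc)
    then show ?thesis by simp
  qed
  ultimately have "\<forall>x\<in>insert y X. diff_embed (q + c) + x \<in> range diff_embed" by simp
  then show ?case by (rule exI)
qed

theorem theorem2p5:
  fixes A :: "'a::{ab_semigroup_add, cancel_semigroup_add} set"
  assumes "J_set A"
  shows "J_set (diff_embed ` A)"
proof (rule J_set_hom_image)
  show "diff_embed (x + y) = diff_embed x + diff_embed y" for x y :: 'a
    by (rule diff_embed_add)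
  show "\<exists>c. \<forall>x\<in>X. c + x \<in> range diff_embed" if "finite X"
    for X :: "'a difference_group set"
    using difference_group_common_denominator [OF that] by blast
  show "J_set A" by (rule assms)
qed

end
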